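(* Let $k\ge 12$ be an integer divisible by $6$, and let $V=\binom{[\frac{7}{3}k]}{k}$ be the family of all $k$-element subsets of $[\frac{7}{3}k]=\{1,\dots,\frac{7}{3}k\}$. Then in every red/blue edge-coloring of the complete graph on vertex set $V$ there is a monochromatic triangle $ABC$ with $A,B,C\in V$ and $A\cap B\cap C=\emptyset$.
   Context: $\binom{[n]}{k}$ denotes the set of all $k$-element subsets of $[n]=\{1,\dots,n\}$. A triangle $ABC$ is monochromatic if its three edges $AB,BC,CA$ all receive the same color. *)

theory Defs
  imports Main "HOL-Library.Ramsey"
begin

text \<open>
  From the library: \<open>[S]\<^bsup>m\<^esup>\<close>, i.e. \<^term>\<open>nsets S m\<close>, is the set of all
  finite subsets of \<open>S\<close> with exactly \<open>m\<close> elements.  Accordingly the edges of the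
  complete graph on a vertex set \<open>V\<close> are the members of \<open>[V]\<^bsup>2\<^esup>\<close>.
\<close>

datatype colour = Red | Blue

text \<open>
  An edge colouring is a total function on sets of vertices; only its values on edges
  are ever inspected.  The vertices of a triangle are pairwise distinct.
\<close>

definition monochromatic_triangle ::
    "'v set \<Rightarrow> ('v set \<Rightarrow> colour) \<Rightarrow> 'v \<Rightarrow> 'v \<Rightarrow> 'v \<Rightarrow> bool" where
  "monochromatic_triangle V c A B C \<longleftrightarrow>
     {A, B} \<in> [V]\<^bsup>2\<^esup> \<and> {B, C} \<in> [V]\<^bsup>2\<^esup> \<and> {C, A} \<in> [V]\<^bsup>2\<^esup> \<and>
     c {A, B} = c {B, C} \<and> c {B, C} = c {C, A}"

end

theory Submission
  imports Defs
begin

text \<open>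
  Put \<open>j = k / 3\<close> and cut the ground set into seven blocks of size \<open>j\<close>, namely the residue classes
  modulo \<open>7\<close>.  Unions of three blocks are vertices, so it suffices to treat \<open>3\<close>-subsets of a
  \<open>7\<close>-element set.  Suppose that no triangle with empty intersection is monochromatic.

  If some \<open>A\<close> is disjoint from \<open>B\<close> and \<open>C\<close> but \<open>AB\<close> and \<open>AC\<close> have different colours, then
  \<open>D \<mapsto> c(AD)\<close> is a proper \<open>2\<close>-colouring of the Kneser graph without the vertices \<open>A, B, C\<close>.
  This graph has four vertex-disjoint \<open>7\<close>-cycles, one of which survives: a contradiction.

  Otherwise all edges from \<open>A\<close> to sets disjoint from \<open>A\<close> have one colour \<open>f(A)\<close>, and it turns out
  that \<open>c(AB)\<close> differs from \<open>f(A)\<close>, and by symmetry from \<open>f(B)\<close>, whenever \<open>A\<close> and \<open>B\<close> have exactly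
  one common block.  Three sets that pairwise share exactly one block, with empty common
  intersection, then form a monochromatic triangle.
\<close>

section \<open>Odd cycles and two colours\<close>

lemma colour_eq_if_neq: "x \<noteq> z \<Longrightarrow> y \<noteq> z \<Longrightarrow> x = y" for x y z :: colour
  by (cases x; cases y; cases z) auto

definition disjoint_cycle :: "'a set list \<Rightarrow> bool" where
  "disjoint_cycle xs \<longleftrightarrow> (\<forall>i<length xs. xs ! i \<inter> xs ! (Suc i mod length xs) = {})"

lemma odd_disjoint_cycle_not_2_colourable:
  fixes P :: "'a set \<Rightarrow> bool"
  assumes "disjoint_cycle xs" and "odd (length xs)"
    and col: "\<And>X Y. X \<in> set xs \<Longrightarrow> Y \<in> set xs \<Longrightarrow> X \<inter> Y = {} \<Longrightarrow> P X \<noteq> P Y"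
  shows False
proof -
  let ?n = "length xs"
  have n: "0 < ?n" using assms(2) by (rule odd_pos)
  have step: "P (xs ! i) \<noteq> P (xs ! (Suc i mod ?n))" if "i < ?n" for i
    using assms(1) that n by (intro col) (auto simp: disjoint_cycle_def)
  have alt: "P (xs ! i) = (P (xs ! 0) = even i)" if "i < ?n" for i
    using that
  proof (induction i)
    case (Suc i)
    then show ?case using step[of i] by auto
  qed simp
  \<comment> \<open>The last index is even, so alternation returns to the value at index 0, yet the
    wrap-around edge joins these two ends.\<close>
  have "P (xs ! (?n - 1)) = P (xs ! 0)"
    using alt[of "?n - 1"] n assms(2) by simp
  moreover have "P (xs ! (?n - 1)) \<noteq> P (xs ! 0)"
    using step[of "?n - 1"] n by simp
  ultimately show False by simp
qed

section \<open>Colour constraints around a vertex\<close>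

locale no_mono_triangle =
  fixes W :: "'a set set" and g :: "'a set \<Rightarrow> 'a set \<Rightarrow> colour"
  assumes nonempty: "{} \<notin> W"
    and sym: "g X Y = g Y X"
    and no_mono: "\<lbrakk>X \<in> W; Y \<in> W; Z \<in> W; X \<noteq> Y; Y \<noteq> Z; X \<noteq> Z; X \<inter> Y \<inter> Z = {}\<rbrakk>
      \<Longrightarrow> \<not> (g X Y = g X Z \<and> g Y Z = g X Z)"
begin

text \<open>The triangles \<open>ABD\<close>, \<open>ABE\<close>, \<open>ADE\<close> each contain a
  disjoint pair, so they force \<open>BD\<close>, \<open>BE\<close>, \<open>DE\<close> into the
  other colour; then \<open>BDE\<close> is monochromatic.\<close>

lemma not_both_same_colour:
  assumes W: "A \<in> W" "B \<in> W" "D \<in> W" "E \<in> W"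
    and disj: "A \<inter> B = {}" "D \<inter> E = {}"
    and neq: "D \<noteq> A" "D \<noteq> B" "E \<noteq> A" "E \<noteq> B"
    and "g A D = g A B" "g A E = g A B"
  shows False
proof -
  have "A \<noteq> B" "D \<noteq> E" using disj W nonempty by auto
  then have "g D E \<noteq> g A B" "g B D \<noteq> g A B" "g B E \<noteq> g A B"
    using no_mono[of A D E] no_mono[of A B D] no_mono[of A B E] assms by auto
  then have "g B D = g B E" "g D E = g B E"
    by (blast intro: colour_eq_if_neq)+
  moreover have "B \<inter> D \<inter> E = {}" using disj by auto
  ultimately show False
    using no_mono[of B D E] W neq \<open>D \<noteq> E\<close> by auto
qed

text \<open>Otherwise \<open>B\<close> and \<open>C\<close> witness both colours at
  \<open>A\<close>, so the edges from \<open>A\<close> to a disjoint pair of other vertices get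
  different colours, which an odd cycle forbids.\<close>

lemma colour_to_disjoint_const:
  assumes W: "A \<in> W" "B \<in> W" "C \<in> W" and disj: "A \<inter> B = {}" "A \<inter> C = {}"
    and xs: "set xs \<subseteq> W" "disjoint_cycle xs" "odd (length xs)" "set xs \<inter> {A, B, C} = {}"
  shows "g A B = g A C"
proof (rule ccontr)
  assume ne: "g A B \<noteq> g A C"
  have "(g A X = g A B) \<noteq> (g A Y = g A B)"
    if XY: "X \<in> set xs" "Y \<in> set xs" "X \<inter> Y = {}" for X Y
  proof -
    have "X \<in> W" "Y \<in> W" and neq: "X \<noteq> A" "X \<noteq> B" "X \<noteq> C" "Y \<noteq> A" "Y \<noteq> B" "Y \<noteq> C"
      using XY xs by auto
    then have "\<not> (g A X = g A B \<and> g A Y = g A B)" "\<not> (g A X = g A C \<and> g A Y = g A C)"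
      using not_both_same_colour[of A B X Y] not_both_same_colour[of A C X Y] W disj XY(3)
      by blast+
    then show ?thesis using ne colour_eq_if_neq by metis
  qed
  then show False
    by (rule odd_disjoint_cycle_not_2_colourable[OF xs(2,3)])
qed

text \<open>Equality would push \<open>BD\<close>, \<open>BE\<close>, \<open>DE\<close> into the
  other colour, again making \<open>BDE\<close> monochromatic.\<close>

lemma colour_neq_to_disjoint:
  assumes W: "A \<in> W" "B \<in> W" "D \<in> W" "E \<in> W"
    and disj: "A \<inter> D = {}" "A \<inter> E = {}" "B \<inter> D \<inter> E = {}"
    and neq: "A \<noteq> B" "B \<noteq> D" "B \<noteq> E" "D \<noteq> E"
    and eq: "g A D = g A E"
  shows "g A B \<noteq> g A D"
proof
  assume AB: "g A B = g A D"
  have "A \<noteq> D" "A \<noteq> E" using disj W nonempty by auto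
  have BD: "g B D \<noteq> g A D"
    using no_mono[OF W(1-3) neq(1,2) \<open>A \<noteq> D\<close>] disj(1) AB by blast
  have BE: "g B E \<noteq> g A D"
    using no_mono[OF W(1,2,4) neq(1,3) \<open>A \<noteq> E\<close>] disj(2) AB eq by auto
  have DE: "g D E \<noteq> g A D"
    using no_mono[OF W(1,3,4) \<open>A \<noteq> D\<close> neq(4) \<open>A \<noteq> E\<close>] disj(2) eq by auto
  show False
    using no_mono[OF W(2-4) neq(2,4,3) disj(3)] colour_eq_if_neq[OF BD BE] colour_eq_if_neq[OF DE BE]
    by simp
qed

end

section \<open>Disjoint 7-cycles in the Kneser graph K(7,3)\<close>

definition kneser_cycles :: "nat set list list" where
  "kneser_cycles =
    [[{0,3,4}, {1,2,5}, {0,4,6}, {1,2,3}, {0,5,6}, {1,3,4}, {2,5,6}],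
     [{0,2,6}, {3,4,5}, {0,1,6}, {2,4,5}, {1,3,6}, {0,2,4}, {1,3,5}],
     [{0,1,3}, {2,4,6}, {0,1,5}, {2,3,4}, {1,5,6}, {0,2,3}, {4,5,6}],
     [{0,2,5}, {1,4,6}, {0,3,5}, {1,2,4}, {3,5,6}, {0,1,2}, {3,4,6}]]"

lemma kneser_cycles:
  assumes "xs \<in> set kneser_cycles"
  shows "set xs \<subseteq> [{..<7}]\<^bsup>3\<^esup>" and "disjoint_cycle xs" and "odd (length xs)"
proof -
  have "list_all (\<lambda>xs. \<forall>X\<in>set xs. X \<subseteq> {..<7} \<and> card X = 3) kneser_cycles"
    by (simp add: kneser_cycles_def)
  then show "set xs \<subseteq> [{..<7}]\<^bsup>3\<^esup>"
    using assms by (auto simp: list_all_iff nsets_def intro: finite_subset)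
  have "list_all (\<lambda>xs. disjoint_cycle xs \<and> odd (length xs)) kneser_cycles"
    unfolding disjoint_cycle_def by code_simp
  then show "disjoint_cycle xs" "odd (length xs)"
    using assms by (auto simp: list_all_iff)
qed

lemma distinct_kneser_cycles: "distinct (concat kneser_cycles)"
  by code_simp

text \<open>Pigeonhole: each of \<open>A\<close>, \<open>B\<close>, \<open>C\<close> lies on at most
  one of the four cycles.\<close>

lemma kneser_cycle_avoiding:
  obtains xs where "xs \<in> set kneser_cycles" and "set xs \<inter> {A, B, C} = {}"
proof -
  obtain p q r s where pqrs: "kneser_cycles = [p, q, r, s]"
    by (simp add: kneser_cycles_def)
  have "set p \<inter> set q = {}" "set p \<inter> set r = {}" "set p \<inter> set s = {}"
    "set q \<inter> set r = {}" "set q \<inter> set s = {}" "set r \<inter> set s = {}"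
    using distinct_kneser_cycles unfolding pqrs by auto
  then have "\<exists>xs\<in>{p, q, r, s}. set xs \<inter> {A, B, C} = {}"
    by (simp add: disjoint_iff) metis
  then show ?thesis using that unfolding pqrs by auto
qed

lemma mono_triangle_3_of_7:
  fixes g :: "nat set \<Rightarrow> nat set \<Rightarrow> colour"
  assumes "no_mono_triangle ([{..<7}]\<^bsup>3\<^esup>) g"
  shows False
proof -
  interpret no_mono_triangle "[{..<7}]\<^bsup>3\<^esup>" g by fact
  note W = nsets_def set_eq_subset
  have const: "g A B = g A C"
    if "A \<in> [{..<7}]\<^bsup>3\<^esup>" "B \<in> [{..<7}]\<^bsup>3\<^esup>" "C \<in> [{..<7}]\<^bsup>3\<^esup>" "A \<inter> B = {}" "A \<inter> C = {}" for A B C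
    using kneser_cycle_avoiding[of A B C] kneser_cycles colour_to_disjoint_const[OF that] by metis
  have neq: "g A B \<noteq> g A D"
    if "A \<in> [{..<7}]\<^bsup>3\<^esup>" "B \<in> [{..<7}]\<^bsup>3\<^esup>" "D \<in> [{..<7}]\<^bsup>3\<^esup>" "E \<in> [{..<7}]\<^bsup>3\<^esup>"
      "A \<inter> D = {}" "A \<inter> E = {}" "B \<inter> D \<inter> E = {}" "A \<noteq> B" "B \<noteq> D" "B \<noteq> E" "D \<noteq> E" for A B D E
    using colour_neq_to_disjoint[OF that] const that by blast
  let ?R = "{0,1,3} :: nat set" and ?S = "{0,2,4} :: nat set" and ?T = "{1,2,5} :: nat set"
  have "g ?R ?S = g ?R ?T"
  proof (rule colour_eq_if_neq)
    \<comment> \<open>In every use of \<open>neq\<close>, \<open>D\<close> and \<open>E\<close>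
      share the two points outside \<open>A \<union> B\<close>, and each adds one of the two points
      of \<open>B - A\<close>; hence \<open>D \<inter> E\<close> misses \<open>B\<close>.\<close>
    show "g ?R ?S \<noteq> g ?R {5,6,2}"
      by (rule neq[where E = "{5,6,4}"]) (auto simp: W)
    have "g ?R ?T \<noteq> g ?R {4,6,2}"
      by (rule neq[where E = "{4,6,5}"]) (auto simp: W)
    also have "g ?R {4,6,2} = g ?R {5,6,2}"
      by (rule const) (auto simp: W)
    finally show "g ?R ?T \<noteq> g ?R {5,6,2}" .
  qed
  moreover have "g ?S ?R = g ?S ?T"
  proof (rule colour_eq_if_neq)
    show "g ?S ?R \<noteq> g ?S {5,6,1}"
      by (rule neq[where E = "{5,6,3}"]) (auto simp: W)
    have "g ?S ?T \<noteq> g ?S {3,6,1}"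
      by (rule neq[where E = "{3,6,5}"]) (auto simp: W)
    also have "g ?S {3,6,1} = g ?S {5,6,1}"
      by (rule const) (auto simp: W)
    finally show "g ?S ?T \<noteq> g ?S {5,6,1}" .
  qed
  moreover have "\<not> (g ?R ?S = g ?R ?T \<and> g ?S ?T = g ?R ?T)"
    by (rule no_mono) (auto simp: W)
  moreover have "g ?S ?R = g ?R ?S" by (rule sym)
  ultimately show False by argo
qed

section \<open>Blowing up seven points to blocks\<close>

definition blowup :: "nat \<Rightarrow> nat set \<Rightarrow> nat set" where
  "blowup j I = {x \<in> {1..7 * j}. x mod 7 \<in> I}"

lemma blowup_Int: "blowup j I \<inter> blowup j J = blowup j (I \<inter> J)"
  by (auto simp: blowup_def)

lemma blowup_empty [simp]: "blowup j {} = {}"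
  by (simp add: blowup_def)

lemma card_blowup:
  assumes "I \<subseteq> {..<7}"
  shows "card (blowup j I) = j * card I"
proof (induction j)
  case (Suc j)
  have fin: "finite (blowup j I)" by (simp add: blowup_def)
  \<comment> \<open>\<open>?h\<close> picks the one new element of each residue class; class 0 is
    represented by the top element, since the ground set starts at 1.\<close>
  let ?h = "\<lambda>i. if i = 0 then 7 * j + 7 else 7 * j + i"
  have "blowup (Suc j) I = blowup j I \<union> ?h ` I"
  proof (intro equalityI subsetI)
    fix x assume x: "x \<in> blowup (Suc j) I"
    show "x \<in> blowup j I \<union> ?h ` I"
    proof (cases "x \<le> 7 * j")
      case True
      then show ?thesis using x by (auto simp: blowup_def)
    next
      case False
      define r where "r = x - 7 * j"
      have r: "x = 7 * j + r" "0 < r" "r \<le> 7"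
        using False x by (auto simp: r_def blowup_def)
      then have "x = ?h (x mod 7)" by (cases "r = 7") simp_all
      moreover have "x mod 7 \<in> I" using x by (simp add: blowup_def)
      ultimately show ?thesis by blast
    qed
  qed (use assms in \<open>auto simp: blowup_def split: if_splits\<close>)
  moreover have "blowup j I \<inter> ?h ` I = {}"
    by (auto simp: blowup_def split: if_splits)
  moreover have "inj_on ?h I"
    using assms by (auto simp: inj_on_def split: if_splits)
  moreover have "finite I" using assms finite_subset by blast
  ultimately have "card (blowup (Suc j) I) = card (blowup j I) + card I"
    using fin by (metis (no_types, lifting) card_Un_disjoint card_image finite_imageI)
  then show ?case using Suc by simp
qed (simp add: blowup_def)

lemma blowup_in_nsets:
  assumes "I \<in> [{..<7}]\<^bsup>3\<^esup>"
  shows "blowup j I \<in> [{1..7 * j}]\<^bsup>(3 * j)\<^esup>"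
proof -
  have "blowup j I \<subseteq> {1..7 * j}" by (auto simp: blowup_def)
  then show ?thesis
    using assms card_blowup[of I j] by (auto simp: nsets_def intro: finite_subset)
qed

lemma blowup_inject:
  assumes "0 < j" "I \<subseteq> {..<7}" "J \<subseteq> {..<7}" "blowup j I = blowup j J"
  shows "I = J"
proof -
  \<comment> \<open>As \<open>j\<close> is positive, each class has a representative among 1 to
    7.\<close>
  have mem: "i \<in> K \<longleftrightarrow> (if i = 0 then 7 else i) \<in> blowup j K" if "i < 7" for i K
    using that assms(1) by (auto simp: blowup_def)
  show ?thesis
  proof (rule set_eqI)
    fix i
    show "i \<in> I \<longleftrightarrow> i \<in> J"
    proof (cases "i < 7")
      case True
      then show ?thesis using mem assms(4) by blast
    next
      case False
      then show ?thesis using assms(2,3) by blast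
    qed
  qed
qed

theorem theorem1p5:
  fixes k :: nat and V :: "nat set set" and c :: "nat set set \<Rightarrow> colour"
  assumes "k \<ge> 12" and "6 dvd k"
    and "V = [{1..7 * k div 3}]\<^bsup>k\<^esup>"
  shows "\<exists>A\<in>V. \<exists>B\<in>V. \<exists>C\<in>V. monochromatic_triangle V c A B C \<and> A \<inter> B \<inter> C = {}"
proof (rule ccontr)
  assume no: "\<not> ?thesis"
  have "3 dvd k" using assms(2) by presburger
  then obtain j where k: "k = 3 * j" by (elim dvdE)
  with assms(1) have j: "0 < j" by simp
  have V: "blowup j I \<in> V" if "I \<in> [{..<7}]\<^bsup>3\<^esup>" for I
    using blowup_in_nsets[OF that, of j] assms(3) k by simp
  have edge: "{X, Y} \<in> [V]\<^bsup>2\<^esup>" if "X \<in> V" "Y \<in> V" "X \<noteq> Y" for X Y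
    using that by (simp add: nsets_def)
  \<comment> \<open>The colouring is pulled back along \<open>blowup j\<close>, which is injective
    here and preserves intersections.\<close>
  have "no_mono_triangle ([{..<7}]\<^bsup>3\<^esup>) (\<lambda>I J. c {blowup j I, blowup j J})"
  proof
    fix I J K :: "nat set"
    assume IJK: "I \<in> [{..<7}]\<^bsup>3\<^esup>" "J \<in> [{..<7}]\<^bsup>3\<^esup>" "K \<in> [{..<7}]\<^bsup>3\<^esup>"
      "I \<noteq> J" "J \<noteq> K" "I \<noteq> K" "I \<inter> J \<inter> K = {}"
    let ?A = "blowup j I" and ?B = "blowup j J" and ?C = "blowup j K"
    have W: "?A \<in> V" "?B \<in> V" "?C \<in> V" using IJK V by blast+
    have "?A \<noteq> ?B" "?B \<noteq> ?C" "?C \<noteq> ?A"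
      using IJK blowup_inject[OF j] by (auto simp: nsets_def)
    then have "{?A, ?B} \<in> [V]\<^bsup>2\<^esup>" "{?B, ?C} \<in> [V]\<^bsup>2\<^esup>" "{?C, ?A} \<in> [V]\<^bsup>2\<^esup>"
      using W edge by blast+
    moreover have "?A \<inter> ?B \<inter> ?C = {}"
      using IJK(7) by (simp add: blowup_Int)
    then have "\<not> monochromatic_triangle V c ?A ?B ?C"
      using no W by blast
    ultimately show "\<not> (c {?A, ?B} = c {?A, ?C} \<and> c {?B, ?C} = c {?A, ?C})"
      by (auto simp: monochromatic_triangle_def insert_commute)
  qed (auto simp: nsets_def insert_commute)
  then show False by (rule mono_triangle_3_of_7)
qed

end
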